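(* Let $\Omega$ be a finite set. A function $\mathrm{Bel}: 2^\Omega \to [0,1]$ is a belief function if and only if the following two conditions hold: (B1) $\mathrm{Bel}(\Omega)=1$; (B2* ) for all $A_1,A_2,\ldots, A_N \subseteq \Omega$ and $B_1,B_2,\ldots, B_M \subseteq \Omega$ such that $$\forall S \subseteq \Omega: \quad \sum_{i=1}^N 1(S \subseteq A_i) \; \geq \; \sum_{j=1}^M 1(S \subseteq B_j),$$ we have $$\sum_{i=1}^N \mathrm{Bel}(A_i) \geq \sum_{j=1}^M \mathrm{Bel}(B_j).$$
   Context: For a finite set $\Omega$, $2^\Omega$ denotes the collection of all subsets of $\Omega$. A basic belief assignment is a function $m: 2^\Omega\to[0,1]$ with $m(\emptyset)=0$ and $\sum_{C\subseteq\Omega} m(C)=1$. A function $\mathrm{Bel}:2^\Omega\to[0,1]$ is a belief function if there is a basic belief assignment $m$ such that $\mathrm{Bel}(A)=\sum_{C\subseteq A} m(C)$ for all $A\subseteq\Omega$. The notation $1(S\subseteq A)$ denotes $1$ if $S\subseteq A$ and $0$ otherwise.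
   Formalization: The condition Bel(∅)=0 is added to (B1) and (B2* ): without it the claim is false, since the constant function Bel=1 satisfies (B1) and (B2* ) (S=∅ forces N≥M) but is not a belief function, as m(∅)=0. *)

theory Defs
  imports Complex_Main "HOL-Library.FuncSet"
begin

text \<open>
  Functions on the power set of \<open>\<Omega>\<close> are total functions on \<open>'a set\<close>; only their values on
  subsets of \<open>\<Omega>\<close> are constrained.
\<close>

definition basic_belief_assignment :: "'a set \<Rightarrow> ('a set \<Rightarrow> real) \<Rightarrow> bool" where
  "basic_belief_assignment \<Omega> m \<longleftrightarrow>
     m \<in> Pow \<Omega> \<rightarrow> {0..1} \<and> m {} = 0 \<and> (\<Sum>C\<in>Pow \<Omega>. m C) = 1"

definition belief_function :: "'a set \<Rightarrow> ('a set \<Rightarrow> real) \<Rightarrow> bool" where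
  "belief_function \<Omega> Bel \<longleftrightarrow>
     Bel \<in> Pow \<Omega> \<rightarrow> {0..1} \<and>
     (\<exists>m. basic_belief_assignment \<Omega> m \<and> (\<forall>A\<subseteq>\<Omega>. Bel A = (\<Sum>C\<in>Pow A. m C)))"

text \<open>
  The quantification over \<open>S\<close> includes \<open>S = {}\<close>, whose instance of the premise
  says \<open>N \<ge> M\<close>. Consequently the constant function 1 satisfies this condition together with
  \<open>Bel \<Omega> = 1\<close>, although it is not a belief function (every belief function vanishes at \<open>{}\<close>,
  because \<open>m {} = 0\<close>). A characterization of belief functions by this condition therefore has
  to state \<open>Bel {} = 0\<close> explicitly.
\<close>

definition B2_star :: "'a set \<Rightarrow> ('a set \<Rightarrow> real) \<Rightarrow> bool" where
  "B2_star \<Omega> Bel \<longleftrightarrow>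
     (\<forall>(N::nat) (M::nat) (A :: nat \<Rightarrow> 'a set) (B :: nat \<Rightarrow> 'a set).
        (\<forall>i\<in>{1..N}. A i \<subseteq> \<Omega>) \<longrightarrow> (\<forall>j\<in>{1..M}. B j \<subseteq> \<Omega>) \<longrightarrow>
        (\<forall>S\<subseteq>\<Omega>. (\<Sum>i=1..N. of_bool (S \<subseteq> A i) :: nat) \<ge> (\<Sum>j=1..M. of_bool (S \<subseteq> B j))) \<longrightarrow>
        (\<Sum>i=1..N. Bel (A i)) \<ge> (\<Sum>j=1..M. Bel (B j)))"

end

(* If Bel comes from the basic belief assignment m, then a sum of values Bel (A i) is the sum of
   the masses m S, each weighted by the number of sets A i containing S, so condition B2-star
   holds because m is nonnegative. Conversely, m is defined by Moebius inversion. Its value at C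
   is the difference between the sums of Bel over those subsets of C whose cardinality has the parity of
   card C and over those whose cardinality has the other parity. Every S is contained in at
   least as many sets of the first family as of the second (equally many unless S = C), so B2-star
   gives m C >= 0. *)

theory Submission
  imports Defs
begin

text \<open>Indicators extend every inner sum to the common range \<open>Pow \<Omega>\<close>, so
  the two summations can be exchanged. Both families in \<open>B2_star\<close> can then be compared
  term by term in \<open>S\<close>.\<close>

lemma sum_of_mass_sums:
  fixes m :: "'a set \<Rightarrow> real" and A :: "nat \<Rightarrow> 'a set"
  assumes "finite \<Omega>" and "\<And>i. i \<in> {1..N} \<Longrightarrow> A i \<subseteq> \<Omega>"
  shows "(\<Sum>i=1..N. sum m (Pow (A i)))
       = (\<Sum>S\<in>Pow \<Omega>. m S * real (\<Sum>i=1..N. of_bool (S \<subseteq> A i)))"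
proof -
  have "sum m (Pow (A i)) = (\<Sum>S\<in>Pow \<Omega>. m S * of_bool (S \<subseteq> A i))" if "i \<in> {1..N}" for i
    by (rule sum.mono_neutral_cong_left) (use assms that in auto)
  then have "(\<Sum>i=1..N. sum m (Pow (A i)))
           = (\<Sum>i=1..N. \<Sum>S\<in>Pow \<Omega>. m S * of_bool (S \<subseteq> A i))"
    by simp
  also have "\<dots> = (\<Sum>S\<in>Pow \<Omega>. \<Sum>i=1..N. m S * of_bool (S \<subseteq> A i))"
    by (rule sum.swap)
  finally show ?thesis
    by (simp add: sum_distrib_left mult.commute)
qed

lemma belief_function_imp_B2_star:
  assumes "finite \<Omega>" and "belief_function \<Omega> Bel"
  shows "B2_star \<Omega> Bel"
proof -
  obtain m where m: "basic_belief_assignment \<Omega> m" "\<And>A. A \<subseteq> \<Omega> \<Longrightarrow> Bel A = sum m (Pow A)"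
    using assms(2) unfolding belief_function_def by auto
  have nonneg: "m S \<ge> 0" if "S \<in> Pow \<Omega>" for S
    using m(1) that unfolding basic_belief_assignment_def by fastforce
  show ?thesis
    unfolding B2_star_def
  proof (intro allI impI)
    fix N M :: nat and A B :: "nat \<Rightarrow> 'a set"
    assume A: "\<forall>i\<in>{1..N}. A i \<subseteq> \<Omega>" and B: "\<forall>j\<in>{1..M}. B j \<subseteq> \<Omega>"
      and le: "\<forall>S\<subseteq>\<Omega>. (\<Sum>j=1..M. of_bool (S \<subseteq> B j)) \<le> (\<Sum>i=1..N. of_bool (S \<subseteq> A i) :: nat)"
    have "(\<Sum>j=1..M. Bel (B j)) = (\<Sum>j=1..M. sum m (Pow (B j)))"
      using B m(2) by simp
    also have "\<dots> = (\<Sum>S\<in>Pow \<Omega>. m S * real (\<Sum>j=1..M. of_bool (S \<subseteq> B j)))"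
      using B by (intro sum_of_mass_sums assms(1)) auto
    also have "\<dots> \<le> (\<Sum>S\<in>Pow \<Omega>. m S * real (\<Sum>i=1..N. of_bool (S \<subseteq> A i)))"
      using le nonneg by (intro sum_mono mult_left_mono of_nat_mono) auto
    also have "\<dots> = (\<Sum>i=1..N. sum m (Pow (A i)))"
      using A by (intro sum_of_mass_sums[symmetric] assms(1)) auto
    also have "\<dots> = (\<Sum>i=1..N. Bel (A i))"
      using A m(2) by simp
    finally show "(\<Sum>j=1..M. Bel (B j)) \<le> (\<Sum>i=1..N. Bel (A i))" .
  qed
qed

text \<open>Enumerating both families bijectively turns \<open>B2_star\<close> into a statement
  about sets of sets. Repetitions do not occur in the families of subsets to which it is applied
  below.\<close>

lemma B2_star_families:
  assumes "B2_star \<Omega> Bel" and "finite \<Omega>" and "\<A> \<subseteq> Pow \<Omega>" and "\<B> \<subseteq> Pow \<Omega>"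
    and le: "\<And>S. S \<subseteq> \<Omega> \<Longrightarrow> card {B \<in> \<B>. S \<subseteq> B} \<le> card {A \<in> \<A>. S \<subseteq> A}"
  shows "sum Bel \<B> \<le> sum Bel \<A>"
proof -
  have fin: "finite \<A>" "finite \<B>"
    using assms by (auto intro: finite_subset)
  obtain a where a: "bij_betw a {1..card \<A>} \<A>"
    using ex_bij_betw_nat_finite_1[OF fin(1)] by blast
  obtain b where b: "bij_betw b {1..card \<B>} \<B>"
    using ex_bij_betw_nat_finite_1[OF fin(2)] by blast
  have count: "(\<Sum>i=1..card \<F>. of_bool (S \<subseteq> f i)) = card {A \<in> \<F>. S \<subseteq> A}"
    if "bij_betw f {1..card \<F>} \<F>" "finite \<F>" for f S and \<F> :: "'a set set"
    using sum.reindex_bij_betw[OF that(1), of "\<lambda>A. of_bool (S \<subseteq> A) :: nat"] that(2)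
    by (simp add: sum_of_bool_eq Int_def)
  have "(\<Sum>j=1..card \<B>. Bel (b j)) \<le> (\<Sum>i=1..card \<A>. Bel (a i))"
  proof (rule assms(1)[unfolded B2_star_def, rule_format])
    show "a i \<subseteq> \<Omega>" if "i \<in> {1..card \<A>}" for i
      using bij_betwE[OF a] that assms(3) by blast
    show "b j \<subseteq> \<Omega>" if "j \<in> {1..card \<B>}" for j
      using bij_betwE[OF b] that assms(4) by blast
  qed (simp only: count[OF a fin(1)] count[OF b fin(2)] le)
  then show ?thesis
    by (simp only: sum.reindex_bij_betw[OF a] sum.reindex_bij_betw[OF b])
qed

text \<open>If \<open>S\<close> is a proper subset of \<open>C\<close>, toggling a fixed element of
  \<open>C - S\<close> pairs the even sets with the odd ones, so the counts agree.\<close>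

lemma card_subsupersets_parity_le:
  assumes "finite C"
  shows "card {T. T \<subseteq> C \<and> S \<subseteq> T \<and> even (card T) \<noteq> even (card C)}
       \<le> card {T. T \<subseteq> C \<and> S \<subseteq> T \<and> even (card T) = even (card C)}"
proof (cases "S \<subset> C")
  case True
  then show ?thesis
    using card_subsupersets_even_odd[OF assms True] by (cases "even (card C)") auto
next
  case False
  \<comment> \<open>Here only \<open>T = C\<close> can lie between \<open>S\<close> and
    \<open>C\<close>, and it has the parity of \<open>C\<close>.\<close>
  then have "{T. T \<subseteq> C \<and> S \<subseteq> T \<and> even (card T) \<noteq> even (card C)} = {}"
    by auto
  then show ?thesis
    by (metis card.empty le0)
qed

text \<open>For finite \<open>C\<close> the two signs multiply to
  \<open>(-1) ^ card (C - T)\<close>, the usual Moebius sign. Keeping them apart exhibits the inner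
  sum as a transform of \<open>Bel\<close>.\<close>

definition moebius_mass :: "('a set \<Rightarrow> real) \<Rightarrow> 'a set \<Rightarrow> real" where
  "moebius_mass Bel C = (-1) ^ card C * (\<Sum>T\<in>Pow C. (-1) ^ card T * Bel T)"

text \<open>On finite sets the transform sending \<open>f\<close> to the sum of
  \<open>(-1) ^ card T * f T\<close> over subsets \<open>T\<close> is an involution. Summing the
  masses applies it a second time.\<close>

lemma sum_moebius_mass:
  assumes "finite A"
  shows "sum (moebius_mass Bel) (Pow A) = Bel A"
  unfolding moebius_mass_def
  by (rule inclusion_exclusion_symmetric[OF refl assms, symmetric])

lemma moebius_mass_nonneg:
  assumes "B2_star \<Omega> Bel" and "finite \<Omega>" and "C \<subseteq> \<Omega>"
  shows "moebius_mass Bel C \<ge> 0"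
proof -
  have C: "finite C"
    using assms finite_subset by blast
  let ?E = "{T \<in> Pow C. even (card T) = even (card C)}"
  let ?O = "{T \<in> Pow C. even (card T) \<noteq> even (card C)}"
  \<comment> \<open>The product of the two signs is 1 exactly when the cardinalities have equal
    parity.\<close>
  have "moebius_mass Bel C = (\<Sum>T\<in>Pow C. if even (card T) = even (card C) then Bel T else - Bel T)"
    unfolding moebius_mass_def sum_distrib_left
    by (rule sum.cong) (auto simp: minus_one_power_iff)
  also have "\<dots> = sum Bel ?E - sum Bel ?O"
    using C by (simp add: sum.If_cases sum_negf Int_def)
  finally have eq: "moebius_mass Bel C = sum Bel ?E - sum Bel ?O" .
  have "sum Bel ?O \<le> sum Bel ?E"
  proof (rule B2_star_families[OF assms(1,2)])
    fix S
    show "card {B \<in> ?O. S \<subseteq> B} \<le> card {A \<in> ?E. S \<subseteq> A}"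
      using card_subsupersets_parity_le[OF C, of S] by (simp add: conj_ac)
  qed (use assms(3) in auto)
  with eq show ?thesis
    by simp
qed

theorem theorem9p2:
  fixes \<Omega> :: "'a set" and Bel :: "'a set \<Rightarrow> real"
  assumes "finite \<Omega>"
    and "Bel \<in> Pow \<Omega> \<rightarrow> {0..1}"
  shows "belief_function \<Omega> Bel \<longleftrightarrow> Bel {} = 0 \<and> Bel \<Omega> = 1 \<and> B2_star \<Omega> Bel"
proof
  assume bel: "belief_function \<Omega> Bel"
  then have "Bel {} = 0 \<and> Bel \<Omega> = 1"
    unfolding belief_function_def basic_belief_assignment_def by auto
  then show "Bel {} = 0 \<and> Bel \<Omega> = 1 \<and> B2_star \<Omega> Bel"
    using belief_function_imp_B2_star[OF assms(1) bel] by blast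
next
  assume B: "Bel {} = 0 \<and> Bel \<Omega> = 1 \<and> B2_star \<Omega> Bel"
  let ?m = "moebius_mass Bel"
  have nonneg: "?m C \<ge> 0" if "C \<in> Pow \<Omega>" for C
    using moebius_mass_nonneg assms(1) B that by blast
  have total: "sum ?m (Pow \<Omega>) = 1"
    using sum_moebius_mass[OF assms(1)] B by simp
  \<comment> \<open>Each mass is one term of a nonnegative sum with total 1.\<close>
  have "?m C \<le> 1" if "C \<in> Pow \<Omega>" for C
    using member_le_sum[OF that, of ?m] nonneg assms(1) total by simp
  \<comment> \<open>At the empty set the alternating sum has the single term
    \<open>Bel {}\<close>.\<close>
  moreover have "?m {} = 0"
    using B by (simp add: moebius_mass_def)
  ultimately have "basic_belief_assignment \<Omega> ?m"
    using nonneg total by (auto simp: basic_belief_assignment_def)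
  moreover have "\<forall>A\<subseteq>\<Omega>. Bel A = sum ?m (Pow A)"
    using assms(1) by (simp add: sum_moebius_mass finite_subset)
  ultimately show "belief_function \<Omega> Bel"
    unfolding belief_function_def using assms(2) by blast
qed

end
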